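(* Let $n\ge2$ and $g\in G$. Consider the linear maps $\mathcal{R},\mathcal{S}:\mathfrak{n}\to\mathbb{R}^{n-1}$ where $\mathcal{R}(X)$ is the vector of the last $n-1$ entries of the first row of $gXg^{-1}$ and $\mathcal{S}(X)$ is the vector of the last $n-1$ entries of the second row of $gXg^{-1}$. Then at least one of $\mathcal{R}$, $\mathcal{S}$ is invertible.
   Context: $G=\mathrm{SO}(1,n)$ realized as the group of $g\in\mathrm{SL}_{n+1}(\mathbb{R})$ with $g\begin{pmatrix}J&0\\0&I_{n-1}\end{pmatrix}g^T=\begin{pmatrix}J&0\\0&I_{n-1}\end{pmatrix}$, $J=\begin{pmatrix}0&1\\1&0\end{pmatrix}$ (the special isometry group of $2x_0x_1+x_2^2+\dots+x_n^2$). Its Lie algebra consists of block matrices $\begin{pmatrix}a&b\\c&d\end{pmatrix}$ with $a\in\mathbb{R}\,\mathrm{diag}(1,-1)$, $b\in M_{2\times(n-1)}(\mathbb{R})$ arbitrary, $c=-b^TJ$, $d=-d^T$. $\mathfrak{n}$ is the abelian subalgebra of elements $X(R)=\begin{pmatrix}0&b\\c&0\end{pmatrix}$ with $b=\begin{pmatrix}R\\0\end{pmatrix}$, $R\in M_{1\times(n-1)}(\mathbb{R})$, $c=-b^TJ$. *)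

theory Defs
  imports "Jordan_Normal_Form.Determinant"
begin

text \<open>Matrices are (n+1)x(n+1) with indices 0..n; the index 0,1 block is the
hyperbolic plane 2 x0 x1, indices 2..n carry x2^2+...+xn^2.\<close>

definition Qform :: "nat \<Rightarrow> real mat" where
  "Qform n = mat (n+1) (n+1) (\<lambda>(i,j).
      if (i = 0 \<and> j = 1) \<or> (i = 1 \<and> j = 0) then 1
      else if 2 \<le> i \<and> i = j then 1 else 0)"

definition SO1n :: "nat \<Rightarrow> real mat set" where
  "SO1n n = {g. g \<in> carrier_mat (n+1) (n+1) \<and> det g = 1 \<and>
                g * Qform n * transpose_mat g = Qform n}"

definition mat_inv :: "nat \<Rightarrow> real mat \<Rightarrow> real mat" where
  "mat_inv n g = (SOME h. h \<in> carrier_mat n n \<and> g * h = 1\<^sub>m n \<and> h * g = 1\<^sub>m n)"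

text \<open>X(R) for R a vector of length n-1 (entries R_0..R_{n-2}):
  b = (R;0), c = -b^T J, so X(0,j+2) = R_j, X(j+2,1) = -R_j.\<close>
definition Xn :: "nat \<Rightarrow> real vec \<Rightarrow> real mat" where
  "Xn n R = mat (n+1) (n+1) (\<lambda>(i,j).
      if i = 0 \<and> 2 \<le> j then R $ (j - 2)
      else if 2 \<le> i \<and> j = 1 then - R $ (i - 2) else 0)"

definition nfrak :: "nat \<Rightarrow> real mat set" where
  "nfrak n = Xn n ` carrier_vec (n - 1)"

text \<open>Last n-1 entries of row k of g X g^{-1}.\<close>
definition rowmap :: "nat \<Rightarrow> real mat \<Rightarrow> nat \<Rightarrow> real mat \<Rightarrow> real vec" where
  "rowmap n g k X = vec (n - 1) (\<lambda>j. (g * X * mat_inv (n+1) g) $$ (k, j + 2))"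

end

theory Submission
  imports Defs
begin

text \<open>Write \<open>Q = Qform n\<close>, \<open>e\<^sub>0\<close> for the first unit vector and \<open>u = (0, 0, R)\<close>. Then
\<open>X(R) = (e\<^sub>0 u\<^sup>T - u e\<^sub>0\<^sup>T) Q\<close>, and since \<open>g\<^sup>-\<^sup>1 = Q g\<^sup>T Q\<close>, conjugation gives
\<open>g X(R) g\<^sup>-\<^sup>1 = (a v\<^sup>T - v a\<^sup>T) Q\<close> with \<open>a = g e\<^sub>0\<close>, \<open>v = g u\<close>; as \<open>Q\<close> fixes the
coordinates \<open>\<ge> 2\<close>, row \<open>k\<close> of the conjugate ends in \<open>a\<^sub>k v\<^sub>j - v\<^sub>k a\<^sub>j\<close> (\<open>j \<ge> 2\<close>).
The column \<open>a\<close> is isotropic and nonzero, so \<open>a\<^sub>0 \<noteq> 0\<close> or \<open>a\<^sub>1 \<noteq> 0\<close>; take \<open>k\<close> with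
\<open>a\<^sub>k \<noteq> 0\<close>. If row \<open>k\<close> vanishes, then \<open>w = a\<^sub>k v - v\<^sub>k a\<close> is zero except possibly at
the coordinate \<open>1 - k\<close>, so it is isotropic; but \<open>w = g (a\<^sub>k u - v\<^sub>k e\<^sub>0)\<close> has
quadratic form \<open>a\<^sub>k\<^sup>2 |R|\<^sup>2\<close>. Hence \<open>R = 0\<close>, and an injective linear
endomorphism of \<open>\<real>\<^sup>n\<^sup>-\<^sup>1\<close> is bijective.\<close>

definition swap01 :: "nat \<Rightarrow> nat" where
  "swap01 i = (if i = 0 then 1 else if i = 1 then 0 else i)"

lemma swap01_less: "1 \<le> n \<Longrightarrow> i < Suc n \<Longrightarrow> swap01 i < Suc n"
  by (auto simp: swap01_def)

lemma Qform_carrier [simp]: "Qform n \<in> carrier_mat (Suc n) (Suc n)"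
  and Qform_dims [simp]: "dim_row (Qform n) = Suc n" "dim_col (Qform n) = Suc n"
  by (simp_all add: Qform_def)

lemma Qform_index:
  "i < Suc n \<Longrightarrow> j < Suc n \<Longrightarrow> Qform n $$ (i, j) = (if i = swap01 j then 1 else 0)"
  by (auto simp: Qform_def swap01_def)

lemma mult_Qform_index:
  assumes "A \<in> carrier_mat m (Suc n)" "i < m" "j < Suc n" "1 \<le> n"
  shows "(A * Qform n) $$ (i, j) = A $$ (i, swap01 j)"
proof -
  have "(A * Qform n) $$ (i, j) = (\<Sum>l\<in>{0..<Suc n}. A $$ (i, l) * Qform n $$ (l, j))"
    using assms by (simp add: scalar_prod_def del: sum.op_ivl_Suc)
  also have "\<dots> = (\<Sum>l\<in>{0..<Suc n}. if l = swap01 j then A $$ (i, l) else 0)"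
    using assms by (intro sum.cong) (auto simp: Qform_index)
  also have "\<dots> = A $$ (i, swap01 j)"
    using assms swap01_less[of n j] by (simp only: sum.delta atLeastLessThan_iff) simp
  finally show ?thesis .
qed

lemma Qform_mult_vec_index:
  assumes "x \<in> carrier_vec (Suc n)" "i < Suc n" "1 \<le> n"
  shows "(Qform n *\<^sub>v x) $ i = x $ swap01 i"
proof -
  have "(Qform n *\<^sub>v x) $ i = (\<Sum>l\<in>{0..<Suc n}. Qform n $$ (i, l) * x $ l)"
    using assms by (simp add: scalar_prod_def del: sum.op_ivl_Suc)
  also have "\<dots> = (\<Sum>l\<in>{0..<Suc n}. if l = swap01 i then x $ l else 0)"
    using assms by (intro sum.cong) (auto simp: Qform_index swap01_def)
  also have "\<dots> = x $ swap01 i"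
    using assms swap01_less[of n i] by (simp only: sum.delta atLeastLessThan_iff) simp
  finally show ?thesis .
qed

lemma Qform_mult_Qform:
  assumes "1 \<le> n"
  shows "Qform n * Qform n = 1\<^sub>m (Suc n)"
proof (rule eq_matI)
  fix i j assume "i < dim_row (1\<^sub>m (Suc n) :: real mat)" "j < dim_col (1\<^sub>m (Suc n) :: real mat)"
  with assms show "(Qform n * Qform n) $$ (i, j) = 1\<^sub>m (Suc n) $$ (i, j)"
    by (subst mult_Qform_index[where m = "Suc n"]) (auto simp: Qform_index swap01_def)
qed auto

definition lorentz_quad :: "nat \<Rightarrow> real vec \<Rightarrow> real" where
  "lorentz_quad n x = x \<bullet> (Qform n *\<^sub>v x)"

lemma lorentz_quad_eq_sum_squares:
  assumes "1 \<le> n" "x \<in> carrier_vec (Suc n)" "x $ 0 * x $ 1 = 0"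
  shows "lorentz_quad n x = (\<Sum>i = 2..n. (x $ i)\<^sup>2)"
proof -
  have "lorentz_quad n x = (\<Sum>i\<in>{0..<Suc n}. x $ i * x $ swap01 i)"
    unfolding lorentz_quad_def scalar_prod_def using assms
    by (intro sum.cong) (auto simp: Qform_mult_vec_index simp del: index_mult_mat_vec)
  also have "{0..<Suc n} = {0, 1} \<union> {2..n}"
    using assms by auto
  also have "(\<Sum>i\<in>{0, 1} \<union> {2..n}. x $ i * x $ swap01 i) = 2 * (x $ 0 * x $ 1) + (\<Sum>i = 2..n. (x $ i)\<^sup>2)"
    by (subst sum.union_disjoint) (auto simp: swap01_def power2_eq_square intro!: sum.cong)
  finally show ?thesis
    using assms by simp
qed

lemma lorentz_quad_eq_0_imp_index_eq_0:
  assumes "1 \<le> n" "x \<in> carrier_vec (Suc n)" "x $ 0 * x $ 1 = 0" "lorentz_quad n x = 0"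
    and "2 \<le> i" "i \<le> n"
  shows "x $ i = 0"
proof -
  have "(\<Sum>i = 2..n. (x $ i)\<^sup>2) = 0"
    using assms lorentz_quad_eq_sum_squares by simp
  then have "(x $ i)\<^sup>2 = 0"
    using assms by (subst (asm) sum_nonneg_eq_0_iff) auto
  then show ?thesis
    by simp
qed

lemma mat_inv_eqI:
  assumes A: "A \<in> carrier_mat n n" and B: "B \<in> carrier_mat n n" and AB: "A * B = 1\<^sub>m n"
  shows "mat_inv n A = B"
  unfolding mat_inv_def
proof (rule some_equality)
  have BA: "B * A = 1\<^sub>m n"
    by (rule mat_mult_left_right_inverse[OF A B AB])
  then show "B \<in> carrier_mat n n \<and> A * B = 1\<^sub>m n \<and> B * A = 1\<^sub>m n"
    using B AB by simp
  fix C assume C: "C \<in> carrier_mat n n \<and> A * C = 1\<^sub>m n \<and> C * A = 1\<^sub>m n"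
  have "C = B * A * C"
    using BA C left_mult_one_mat[of C n n] by simp
  also have "\<dots> = B * (A * C)"
    using A B C by (intro assoc_mult_mat) auto
  finally show "C = B"
    using B C by simp
qed

lemma bij_betw_mult_mat_vec:
  fixes A :: "'a :: field mat"
  assumes A: "A \<in> carrier_mat m m"
    and kernel: "\<And>x. x \<in> carrier_vec m \<Longrightarrow> A *\<^sub>v x = 0\<^sub>v m \<Longrightarrow> x = 0\<^sub>v m"
  shows "bij_betw ((*\<^sub>v) A) (carrier_vec m) (carrier_vec m)"
proof -
  have "det A \<noteq> 0"
    using det_0_iff_vec_prod_zero[OF A] kernel by blast
  then obtain B where B: "B \<in> carrier_mat m m" "B * A = 1\<^sub>m m" "A * B = 1\<^sub>m m"
    using det_non_zero_imp_unit[OF A] by (auto simp: Units_def ring_mat_simps)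
  show ?thesis
    by (rule bij_betw_byWitness[where f' = "(*\<^sub>v) B"])
      (use A B in \<open>auto simp: assoc_mult_mat_vec[symmetric]\<close>)+
qed

definition outer_prod :: "'a :: comm_semiring_1 vec \<Rightarrow> 'a vec \<Rightarrow> 'a mat" where
  "outer_prod x y = mat (dim_vec x) (dim_vec y) (\<lambda>(i, j). x $ i * y $ j)"

lemma outer_prod_carrier [simp]:
  "x \<in> carrier_vec m \<Longrightarrow> y \<in> carrier_vec p \<Longrightarrow> outer_prod x y \<in> carrier_mat m p"
  by (simp add: outer_prod_def)

lemma transpose_outer_prod: "transpose_mat (outer_prod x y) = outer_prod y x"
  by (rule eq_matI) (auto simp: outer_prod_def mult.commute)

lemma mult_outer_prod:
  assumes "A \<in> carrier_mat m n" "x \<in> carrier_vec n"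
  shows "A * outer_prod x y = outer_prod (A *\<^sub>v x) y"
  using assms
  by (intro eq_matI) (auto simp: outer_prod_def scalar_prod_def sum_distrib_right mult.assoc)

lemma mult_outer_prod_mult_transpose:
  assumes A: "A \<in> carrier_mat m n" and x: "x \<in> carrier_vec n"
    and B: "B \<in> carrier_mat p q" and y: "y \<in> carrier_vec q"
  shows "A * outer_prod x y * transpose_mat B = outer_prod (A *\<^sub>v x) (B *\<^sub>v y)"
proof -
  have Ax: "A *\<^sub>v x \<in> carrier_vec m"
    using A x by simp
  have "A * outer_prod x y * transpose_mat B = transpose_mat (B * outer_prod y (A *\<^sub>v x))"
    using transpose_mult[OF B outer_prod_carrier[OF y Ax]]
    by (simp add: mult_outer_prod[OF A x] transpose_outer_prod)
  also have "\<dots> = outer_prod (A *\<^sub>v x) (B *\<^sub>v y)"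
    by (simp add: mult_outer_prod[OF B y] transpose_outer_prod)
  finally show ?thesis .
qed

definition lift_vec :: "nat \<Rightarrow> real vec \<Rightarrow> real vec" where
  "lift_vec n R = vec (Suc n) (\<lambda>i. if 2 \<le> i then R $ (i - 2) else 0)"

lemma lift_vec_carrier [simp]: "lift_vec n R \<in> carrier_vec (Suc n)"
  and lift_vec_dim [simp]: "dim_vec (lift_vec n R) = Suc n"
  by (simp_all add: lift_vec_def)

lemma Xn_eq_outer_prod:
  assumes "1 \<le> n"
  shows "Xn n R = (outer_prod (unit_vec (Suc n) 0) (lift_vec n R)
                   - outer_prod (lift_vec n R) (unit_vec (Suc n) 0)) * Qform n"
    (is "_ = ?W * _")
proof (rule eq_matI)
  fix i j assume "i < dim_row (?W * Qform n)" "j < dim_col (?W * Qform n)"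
  with assms show "Xn n R $$ (i, j) = (?W * Qform n) $$ (i, j)"
    by (subst mult_Qform_index[where m = "Suc n"])
      (auto simp: Xn_def outer_prod_def lift_vec_def swap01_def)
qed (auto simp: Xn_def outer_prod_def)

lemma mult_lift_vec_index:
  assumes "A \<in> carrier_mat m (Suc n)" "c < m" "1 \<le> n"
  shows "(A *\<^sub>v lift_vec n R) $ c = (\<Sum>l = 0..<n - 1. A $$ (c, l + 2) * R $ l)"
proof -
  have "(A *\<^sub>v lift_vec n R) $ c = (\<Sum>l = 0..<Suc n. A $$ (c, l) * lift_vec n R $ l)"
    using assms by (simp add: scalar_prod_def del: sum.op_ivl_Suc)
  also have "\<dots> = (\<Sum>l = 2..<Suc n. A $$ (c, l) * lift_vec n R $ l)"
    by (rule sum.mono_neutral_right) (auto simp: lift_vec_def)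
  also have "{2..<Suc n} = {0 + 2..<(n - 1) + 2}"
    using assms by auto
  also have "(\<Sum>l\<in>\<dots>. A $$ (c, l) * lift_vec n R $ l)
      = (\<Sum>l = 0..<n - 1. A $$ (c, l + 2) * lift_vec n R $ (l + 2))"
    by (rule sum.shift_bounds_nat_ivl)
  also have "\<dots> = (\<Sum>l = 0..<n - 1. A $$ (c, l + 2) * R $ l)"
    by (intro sum.cong) (auto simp: lift_vec_def)
  finally show ?thesis .
qed

definition rowmap_mat :: "nat \<Rightarrow> real mat \<Rightarrow> nat \<Rightarrow> real mat" where
  "rowmap_mat n g k = mat (n - 1) (n - 1)
     (\<lambda>(j, l). g $$ (k, 0) * g $$ (j + 2, l + 2) - g $$ (j + 2, 0) * g $$ (k, l + 2))"

locale SO1n_element =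
  fixes n :: nat and g :: "real mat"
  assumes one_le_n: "1 \<le> n" and g_SO1n: "g \<in> SO1n n"
begin

abbreviation Q :: "real mat" where "Q \<equiv> Qform n"

lemma g_carrier [simp]: "g \<in> carrier_mat (Suc n) (Suc n)"
  using g_SO1n by (simp add: SO1n_def)

lemma g_dims [simp]: "dim_row g = Suc n" "dim_col g = Suc n"
  using carrier_matD[OF g_carrier] by auto

text \<open>Library facts specialised to the dimension \<open>Suc n\<close>: in the originals the inner dimensions
occur only in the premises, so the simplifier cannot use them.\<close>

lemma square_mult_vec_carrier [simp]:
  "A \<in> carrier_mat (Suc n) (Suc n) \<Longrightarrow> x \<in> carrier_vec (Suc n) \<Longrightarrow> A *\<^sub>v x \<in> carrier_vec (Suc n)"
  by (rule mult_mat_vec_carrier)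

lemma square_mult_carrier [simp]:
  "A \<in> carrier_mat (Suc n) (Suc n) \<Longrightarrow> B \<in> carrier_mat (Suc n) (Suc n) \<Longrightarrow> A * B \<in> carrier_mat (Suc n) (Suc n)"
  by (rule mult_carrier_mat)

lemma square_mult_assoc:
  "A \<in> carrier_mat (Suc n) (Suc n) \<Longrightarrow> B \<in> carrier_mat (Suc n) (Suc n) \<Longrightarrow> C \<in> carrier_mat (Suc n) (Suc n)
   \<Longrightarrow> A * B * C = A * (B * C)"
  by (rule assoc_mult_mat)

lemma square_mult_mat_vec_assoc:
  "A \<in> carrier_mat (Suc n) (Suc n) \<Longrightarrow> B \<in> carrier_mat (Suc n) (Suc n) \<Longrightarrow> x \<in> carrier_vec (Suc n)
   \<Longrightarrow> (A * B) *\<^sub>v x = A *\<^sub>v (B *\<^sub>v x)"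
  by (rule assoc_mult_mat_vec)

lemma Q_mult_Q [simp]: "Q * Q = 1\<^sub>m (Suc n)"
  using Qform_mult_Qform[OF one_le_n] by simp

lemma Q_mult_Q_mult [simp]: "M \<in> carrier_mat (Suc n) (Suc n) \<Longrightarrow> Q * (Q * M) = M"
  by (simp flip: square_mult_assoc)

lemma g_mult_Q_transpose_Q: "g * (Q * transpose_mat g * Q) = 1\<^sub>m (Suc n)"
proof -
  have "g * (Q * transpose_mat g * Q) = g * Q * transpose_mat g * Q"
    by (simp add: square_mult_assoc)
  also have "g * Q * transpose_mat g = Q"
    using g_SO1n by (simp add: SO1n_def)
  finally show ?thesis
    by simp
qed

lemma mat_inv_g: "mat_inv (Suc n) g = Q * transpose_mat g * Q"
  using g_mult_Q_transpose_Q by (intro mat_inv_eqI) simp_all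

lemma transpose_g_mult_Q_mult_g: "transpose_mat g * Q * g = Q"
proof -
  have "Q * transpose_mat g * Q * g = 1\<^sub>m (Suc n)"
    using mat_mult_left_right_inverse[OF g_carrier _ g_mult_Q_transpose_Q] by simp
  then have "Q * (Q * transpose_mat g * Q * g) = Q"
    by simp
  then show ?thesis
    by (simp add: square_mult_assoc)
qed

lemma lorentz_quad_mult_g:
  assumes x: "x \<in> carrier_vec (Suc n)"
  shows "lorentz_quad n (g *\<^sub>v x) = lorentz_quad n x"
proof -
  have gx: "g *\<^sub>v x \<in> carrier_vec (Suc n)" and Qgx: "Q *\<^sub>v (g *\<^sub>v x) \<in> carrier_vec (Suc n)"
    using x by simp_all
  have "lorentz_quad n (g *\<^sub>v x) = (transpose_mat g *\<^sub>v (Q *\<^sub>v (g *\<^sub>v x))) \<bullet> x"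
    unfolding lorentz_quad_def
    using x comm_scalar_prod[OF gx Qgx] transpose_vec_mult_scalar[OF g_carrier _ Qgx] by simp
  also have "transpose_mat g *\<^sub>v (Q *\<^sub>v (g *\<^sub>v x)) = (transpose_mat g * Q * g) *\<^sub>v x"
    using x by (simp add: square_mult_mat_vec_assoc)
  also have "\<dots> = Q *\<^sub>v x"
    by (simp add: transpose_g_mult_Q_mult_g)
  finally show ?thesis
    unfolding lorentz_quad_def using x by (simp add: comm_scalar_prod[of _ "Suc n"])
qed

lemma first_column_01_nonzero: "g $$ (0, 0) \<noteq> 0 \<or> g $$ (1, 0) \<noteq> 0"
proof (rule ccontr)
  assume "\<not> ?thesis"
  then have first: "g $$ (i, 0) = 0" if "i < 2" for i
    using that by (auto simp: less_2_cases_iff)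
  have e0: "unit_vec (Suc n) 0 \<in> carrier_vec (Suc n)" "(unit_vec (Suc n) 0 :: real vec) $ 0 * unit_vec (Suc n) 0 $ 1 = 0"
    using one_le_n by simp_all
  have isotropic: "lorentz_quad n (g *\<^sub>v unit_vec (Suc n) 0) = 0"
    using lorentz_quad_mult_g[OF e0(1)] lorentz_quad_eq_sum_squares[OF one_le_n e0] by simp
  have "g *\<^sub>v unit_vec (Suc n) 0 = 0\<^sub>v (Suc n)"
  proof (rule eq_vecI)
    fix i assume "i < dim_vec (0\<^sub>v (Suc n) :: real vec)"
    then show "(g *\<^sub>v unit_vec (Suc n) 0) $ i = 0\<^sub>v (Suc n) $ i"
      using first lorentz_quad_eq_0_imp_index_eq_0[OF one_le_n _ _ isotropic, of i]
      by (cases "i < 2") simp_all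
  qed simp
  moreover have "det g \<noteq> 0"
    using g_SO1n by (simp add: SO1n_def)
  moreover have "unit_vec (Suc n) 0 \<noteq> (0\<^sub>v (Suc n) :: real vec)"
  proof
    assume "unit_vec (Suc n) 0 = (0\<^sub>v (Suc n) :: real vec)"
    then have "unit_vec (Suc n) 0 $ 0 = (0\<^sub>v (Suc n) :: real vec) $ 0"
      by simp
    then show False
      by simp
  qed
  ultimately show False
    using det_0_iff_vec_prod_zero[OF g_carrier] e0(1) by blast
qed

lemma conj_Xn:
  "g * Xn n R * mat_inv (Suc n) g
     = (outer_prod (g *\<^sub>v unit_vec (Suc n) 0) (g *\<^sub>v lift_vec n R)
        - outer_prod (g *\<^sub>v lift_vec n R) (g *\<^sub>v unit_vec (Suc n) 0)) * Q"
proof -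
  let ?P = "outer_prod (unit_vec (Suc n) 0) (lift_vec n R)"
  let ?P' = "outer_prod (lift_vec n R) (unit_vec (Suc n) 0)"
  have P: "?P \<in> carrier_mat (Suc n) (Suc n)" "?P' \<in> carrier_mat (Suc n) (Suc n)"
    "?P - ?P' \<in> carrier_mat (Suc n) (Suc n)"
    by (simp_all add: minus_carrier_mat)
  have "g * Xn n R * mat_inv (Suc n) g = g * ((?P - ?P') * Q) * (Q * transpose_mat g * Q)"
    by (simp add: Xn_eq_outer_prod[OF one_le_n] mat_inv_g)
  also have "\<dots> = g * (?P - ?P') * transpose_mat g * Q"
    using P by (simp add: square_mult_assoc)
  also have "g * (?P - ?P') = g * ?P - g * ?P'"
    by (rule mult_minus_distrib_mat[OF g_carrier P(1,2)])
  also have "(g * ?P - g * ?P') * transpose_mat g = g * ?P * transpose_mat g - g * ?P' * transpose_mat g"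
    using P by (intro minus_mult_distrib_mat[where nr = "Suc n" and n = "Suc n" and nc = "Suc n"]) auto
  also have "\<dots> = outer_prod (g *\<^sub>v unit_vec (Suc n) 0) (g *\<^sub>v lift_vec n R)
        - outer_prod (g *\<^sub>v lift_vec n R) (g *\<^sub>v unit_vec (Suc n) 0)"
    using mult_outer_prod_mult_transpose[OF g_carrier _ g_carrier] by simp
  finally show ?thesis .
qed

lemma rowmap_Xn_index:
  assumes "k < Suc n" "j < n - 1"
  shows "rowmap n g k (Xn n R) $ j
    = g $$ (k, 0) * (g *\<^sub>v lift_vec n R) $ (j + 2) - (g *\<^sub>v lift_vec n R) $ k * g $$ (j + 2, 0)"
proof -
  let ?W = "outer_prod (g *\<^sub>v unit_vec (Suc n) 0) (g *\<^sub>v lift_vec n R)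
        - outer_prod (g *\<^sub>v lift_vec n R) (g *\<^sub>v unit_vec (Suc n) 0)"
  have W: "?W \<in> carrier_mat (Suc n) (Suc n)"
    by (simp add: minus_carrier_mat)
  have "rowmap n g k (Xn n R) $ j = (?W * Q) $$ (k, j + 2)"
    using assms by (simp add: rowmap_def conj_Xn del: index_mult_mat)
  also have "\<dots> = ?W $$ (k, swap01 (j + 2))"
    using assms by (intro mult_Qform_index[OF W]) auto
  also have "\<dots> = g $$ (k, 0) * (g *\<^sub>v lift_vec n R) $ (j + 2) - (g *\<^sub>v lift_vec n R) $ k * g $$ (j + 2, 0)"
    using assms by (simp add: outer_prod_def swap01_def)
  finally show ?thesis .
qed

lemma rowmap_Xn_eq_mult_mat_vec:
  assumes k: "k < Suc n" and R: "R \<in> carrier_vec (n - 1)"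
  shows "rowmap n g k (Xn n R) = rowmap_mat n g k *\<^sub>v R"
proof (rule eq_vecI)
  fix j assume "j < dim_vec (rowmap_mat n g k *\<^sub>v R)"
  then have j: "j < n - 1"
    by (simp add: rowmap_mat_def)
  have "(rowmap_mat n g k *\<^sub>v R) $ j
      = (\<Sum>l = 0..<n - 1. (g $$ (k, 0) * g $$ (j + 2, l + 2) - g $$ (j + 2, 0) * g $$ (k, l + 2)) * R $ l)"
    using j R by (simp add: rowmap_mat_def scalar_prod_def)
  also have "\<dots> = g $$ (k, 0) * (\<Sum>l = 0..<n - 1. g $$ (j + 2, l + 2) * R $ l)
                 - g $$ (j + 2, 0) * (\<Sum>l = 0..<n - 1. g $$ (k, l + 2) * R $ l)"
    by (simp add: sum_distrib_left sum_subtractf[symmetric] algebra_simps)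
  also have "\<dots> = rowmap n g k (Xn n R) $ j"
    using j k one_le_n
    by (simp add: rowmap_Xn_index mult_lift_vec_index[OF g_carrier] del: index_mult_mat_vec)
  finally show "rowmap n g k (Xn n R) $ j = (rowmap_mat n g k *\<^sub>v R) $ j"
    by simp
qed (simp add: rowmap_def rowmap_mat_def)

lemma rowmap_Xn_eq_0_imp:
  assumes k: "k < 2" and gk: "g $$ (k, 0) \<noteq> 0" and R: "R \<in> carrier_vec (n - 1)"
    and zero: "rowmap n g k (Xn n R) = 0\<^sub>v (n - 1)"
  shows "R = 0\<^sub>v (n - 1)"
proof -
  let ?u = "lift_vec n R"
  define y where "y = g $$ (k, 0) \<cdot>\<^sub>v ?u - (g *\<^sub>v ?u) $ k \<cdot>\<^sub>v unit_vec (Suc n) 0"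
  have y: "y \<in> carrier_vec (Suc n)"
    by (simp add: y_def)
  have gy: "(g *\<^sub>v y) $ i = g $$ (k, 0) * (g *\<^sub>v ?u) $ i - (g *\<^sub>v ?u) $ k * g $$ (i, 0)"
    if "i < Suc n" for i
    using that by (simp add: y_def mult_minus_distrib_mat_vec[OF g_carrier] mult_mat_vec[OF g_carrier])
  have gy_vanishes: "(g *\<^sub>v y) $ i = 0" if "i < Suc n" "i = k \<or> 2 \<le> i" for i
  proof (cases "i = k")
    case True
    then show ?thesis
      using that by (simp add: gy mult.commute del: index_mult_mat_vec)
  next
    case False
    then have "i - 2 < n - 1" "i = (i - 2) + 2"
      using that by auto
    moreover have "rowmap n g k (Xn n R) $ (i - 2) = 0"
      using zero \<open>i - 2 < n - 1\<close> by simp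
    ultimately show ?thesis
      using that k rowmap_Xn_index[of k "i - 2" R] by (simp add: gy del: index_mult_mat_vec)
  qed
  have "lorentz_quad n (g *\<^sub>v y) = 0"
  proof -
    have "(g *\<^sub>v y) $ 0 * (g *\<^sub>v y) $ 1 = 0"
      using k gy_vanishes[of 0] gy_vanishes[of 1] one_le_n by (auto simp: less_2_cases_iff)
    then have "lorentz_quad n (g *\<^sub>v y) = (\<Sum>i = 2..n. ((g *\<^sub>v y) $ i)\<^sup>2)"
      using y by (intro lorentz_quad_eq_sum_squares[OF one_le_n]) simp_all
    also have "\<dots> = 0"
      using gy_vanishes by (intro sum.neutral) auto
    finally show ?thesis .
  qed
  then have isotropic: "lorentz_quad n y = 0"
    using lorentz_quad_mult_g[OF y] by simp
  have y01: "y $ 0 * y $ 1 = 0"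
    using one_le_n by (simp add: y_def lift_vec_def)
  show ?thesis
  proof (rule eq_vecI)
    fix j assume "j < dim_vec (0\<^sub>v (n - 1) :: real vec)"
    then have j: "j < n - 1"
      by simp
    have "y $ (j + 2) = 0"
      using j by (intro lorentz_quad_eq_0_imp_index_eq_0[OF one_le_n y y01 isotropic]) auto
    then show "R $ j = 0\<^sub>v (n - 1) $ j"
      using j gk by (simp add: y_def lift_vec_def)
  qed (use R in simp)
qed

lemma bij_betw_rowmap:
  assumes "k < 2" "g $$ (k, 0) \<noteq> 0"
  shows "bij_betw (rowmap n g k) (nfrak n) (carrier_vec (n - 1))"
proof -
  have k: "k < Suc n"
    using assms one_le_n by simp
  have "bij_betw ((*\<^sub>v) (rowmap_mat n g k)) (carrier_vec (n - 1)) (carrier_vec (n - 1))"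
    using assms rowmap_Xn_eq_0_imp rowmap_Xn_eq_mult_mat_vec[OF k]
    by (intro bij_betw_mult_mat_vec) (auto simp: rowmap_mat_def)
  moreover have "bij_betw (rowmap n g k \<circ> Xn n) (carrier_vec (n - 1)) (carrier_vec (n - 1))
      \<longleftrightarrow> bij_betw ((*\<^sub>v) (rowmap_mat n g k)) (carrier_vec (n - 1)) (carrier_vec (n - 1))"
    by (rule bij_betw_cong) (simp add: rowmap_Xn_eq_mult_mat_vec[OF k])
  ultimately have "bij_betw (rowmap n g k \<circ> Xn n) (carrier_vec (n - 1)) (carrier_vec (n - 1))"
    by simp
  then show ?thesis
    unfolding nfrak_def bij_betw_def by (simp add: inj_on_imageI image_comp)
qed

end

theorem lemma6:
  fixes n :: nat and g :: "real mat"
  assumes "n \<ge> 2" and "g \<in> SO1n n"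
  shows "bij_betw (rowmap n g 0) (nfrak n) (carrier_vec (n - 1))
       \<or> bij_betw (rowmap n g 1) (nfrak n) (carrier_vec (n - 1))"
proof -
  interpret SO1n_element n g
    using assms by unfold_locales simp_all
  show ?thesis
    using first_column_01_nonzero bij_betw_rowmap[of 0] bij_betw_rowmap[of 1] by auto
qed

end
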